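(* Let $\ell\ge 1$ be an integer and let $v=(v_1,\dots, v_{2\ell})$ be a vector with $\ell$ entries equal to $0$ and $\ell$ entries equal to $1$. (i) Assume $v_i=0$ for a unique $1\leq i\leq \ell$. Then $v$ is a stable gap vector if and only if (a) $i=1$, or (b) $2\leq i\leq \ell$ and $v_{2\ell}=1$. (ii) Assume $v_1=\dots = v_{\ell-2}=1$ and that $v_{\ell+m}=v_{\ell+n}=1$ for $0\leq m <n \leq \ell$. Then $v$ is a stable gap vector if and only if (a) $n=\ell-1$ and $\ell/2-1\leq m\leq \ell-2$, or (b) $n=\ell$ and $0\leq m \leq \ell/2-1$. (iii) Assume $v_2=v_4=\dots =v_{2\ell}=1$. Then $v$ is a stable gap vector. (iv) Assume $\ell \geq 5$, $v_2=\dots=v_{\ell-2}=v_\ell=1$, and that $v_{\ell+m}=v_{\ell+n}=1$ for some $1\leq m<n\leq \ell$. Then $v$ is a stable gap vector if and only if (a) $1\leq m <n\leq \ell-2$ with $m\neq \ell-3$ and $n\neq \ell-3$, or (b) $m=1$ and $n=\ell-1$, or (c) $\ell \geq 6$, $m=2$ and $n=\ell$. (v) Assume $v_2=\dots=v_{\ell -1}=1$, and that $v_{\ell+m}=v_{\ell+n}=1$ for some $1\leq m<n\leq \ell$. Then $v$ is a stable gap vector if and only if (a) $2\leq m<n\leq \ell -2$, or (b) $m=1$ and $n\neq \ell-1$.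
   Context: A numerical semigroup $\Lambda$ is a subset of $\mathbb{N}_0$ containing $0$, closed under addition, with finite complement in $\mathbb{N}_0$. The elements of $Gaps(\Lambda)=\mathbb{N}_0\setminus\Lambda$ are its gaps, and the genus $g(\Lambda)$ is the number of gaps. The set of pseudo-Frobenius numbers is $PF(\Lambda)=\{x\in\mathbb{Z}\setminus\Lambda : x+\lambda\in\Lambda \text{ for all } \lambda\in\Lambda\setminus\{0\}\}$ and the type is $t(\Lambda)=|PF(\Lambda)|$. If $\Lambda$ has genus $g>0$ and type $g-\ell$ with $\ell\ge 1$, then $\{1,\dots,g-\ell\}\subseteq Gaps(\Lambda)\subseteq\{1,\dots,g+\ell\}$. The gap vector of $\Lambda$ is the $(0/1)$-vector $v(\Lambda)=(v_1,\dots,v_{2\ell})$ with $v_i=1$ if $g-\ell+i\in Gaps(\Lambda)$ and $v_i=0$ otherwise. A vector $v\in\mathbb{Z}^{2\ell}$ is called a stable gap vector if there exists a numerical semigroup $\Lambda$ of genus $g$ and type $g-\ell$ with $v=v(\Lambda)$ for some (equivalently, for all) integers $g\ge 3\ell-1$.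
   Formalization: Part (v) is stated for ℓ ≥ 3: for ℓ = 2, with the chain v_2=…=v_{ℓ-1} read as empty, the only vector is (0,0,1,1) with m=1, n=2, which satisfies (b) but is not a stable gap vector. *)

theory Defs
  imports Complex_Main
begin

definition gaps :: "nat set \<Rightarrow> nat set" where
  "gaps \<Lambda> = UNIV - \<Lambda>"

definition numerical_semigroup :: "nat set \<Rightarrow> bool" where
  "numerical_semigroup \<Lambda> \<longleftrightarrow>
     0 \<in> \<Lambda> \<and> (\<forall>x\<in>\<Lambda>. \<forall>y\<in>\<Lambda>. x + y \<in> \<Lambda>) \<and> finite (gaps \<Lambda>)"

definition genus :: "nat set \<Rightarrow> nat" where
  "genus \<Lambda> = card (gaps \<Lambda>)"

definition pseudo_frobenius :: "nat set \<Rightarrow> int set" where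
  "pseudo_frobenius \<Lambda> =
     {x. x \<notin> int ` \<Lambda> \<and> (\<forall>y \<in> \<Lambda> - {0}. x + int y \<in> int ` \<Lambda>)}"

definition semigroup_type :: "nat set \<Rightarrow> nat" where
  "semigroup_type \<Lambda> = card (pseudo_frobenius \<Lambda>)"

(* Vectors (v_1, ..., v_{2l}) are functions nat => int of which only the values at the
   indices 1, ..., 2l matter.  The subtraction below truncates only if genus < l, which
   the bound on g in stable_gap_vector excludes. *)
definition gap_vector :: "nat \<Rightarrow> nat set \<Rightarrow> nat \<Rightarrow> int" where
  "gap_vector l \<Lambda> i = (if genus \<Lambda> - l + i \<in> gaps \<Lambda> then 1 else 0)"

(* Existence for some g \<ge> 3l - 1; for l \<ge> 1 this is equivalent to existence for all such g. *)
definition stable_gap_vector :: "nat \<Rightarrow> (nat \<Rightarrow> int) \<Rightarrow> bool" where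
  "stable_gap_vector l v \<longleftrightarrow>
     (\<exists>g \<ge> 3 * l - 1. \<exists>\<Lambda>. numerical_semigroup \<Lambda> \<and> genus \<Lambda> = g \<and> semigroup_type \<Lambda> = g - l \<and>
        (\<forall>i\<in>{1..2 * l}. v i = gap_vector l \<Lambda> i))"

end

theory Submission
  imports Defs
begin

text \<open>
  A gap x is not pseudo-Frobenius iff x = c - y for some gap c and some nonzero y in the
  semigroup.  Since the type is less than the multiplicity, a semigroup of genus g and type
  g - l whose gap vector has l ones has all its gaps in {1..g + l}, with none of 1, ..., g - l in
  the semigroup; so these differences are the b - a > 0 with v_a = 0 and v_b = 1.  Conversely,
  for g = 3l - 1 every vector with l zeros and l ones gives a semigroup, because any two
  nonzero elements have sum at least 2(g - l + 1) > g + l.  Hence v is stable iff there are exactly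
  l such differences, and each of the five families reduces to counting them.
\<close>

section \<open>Differences from zeros to ones, and gaps that are not pseudo-Frobenius\<close>

text \<open>\<open>S\<close> stands for the positions of the ones in a 0/1 vector of length
  \<open>N\<close>, so \<open>{1..N} - S\<close> holds the zeros. The genus does not enter, which is
  why stability can be tested at a single genus.\<close>

definition gap_differences :: "nat \<Rightarrow> nat set \<Rightarrow> nat set" where
  "gap_differences N S = {d. \<exists>a\<in>{1..N} - S. a + d \<in> S \<and> 0 < d}"

lemma gap_differencesE:
  assumes "d \<in> gap_differences N S"
  obtains a where "1 \<le> a" "a \<le> N" "a \<notin> S" "a + d \<in> S" "0 < d"
  using assms by (auto simp: gap_differences_def)

text \<open>In a semigroup every such \<open>x\<close> is itself a gap, by closure under addition.
  These are the gaps that fail to be pseudo-Frobenius.\<close>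

definition non_pseudo_frobenius :: "nat set \<Rightarrow> nat set" where
  "non_pseudo_frobenius \<Lambda> = {x. \<exists>y\<in>\<Lambda> - {0}. x + y \<in> gaps \<Lambda>}"

lemma mult_mem_numerical_semigroup:
  assumes "numerical_semigroup \<Lambda>" "x \<in> \<Lambda>"
  shows "x * k \<in> \<Lambda>"
  using assms by (induction k) (auto simp: numerical_semigroup_def)

lemma non_pseudo_frobenius_subset_gaps:
  assumes "numerical_semigroup \<Lambda>"
  shows "non_pseudo_frobenius \<Lambda> \<subseteq> gaps \<Lambda>"
  using assms by (auto simp: non_pseudo_frobenius_def gaps_def numerical_semigroup_def)

text \<open>Let \<open>F\<close> be the largest gap. A negative \<open>x\<close> is never
  pseudo-Frobenius: F - x lies beyond \<open>F\<close>, hence in \<open>\<Lambda>\<close>, yet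
  adding \<open>x\<close> to it gives \<open>F\<close>. Positive genus supplies \<open>F\<close>;
  for the semigroup of all naturals, -1 would be pseudo-Frobenius.\<close>

lemma pseudo_frobenius_eq_image:
  assumes "numerical_semigroup \<Lambda>" "genus \<Lambda> > 0"
  shows "pseudo_frobenius \<Lambda> = int ` (gaps \<Lambda> - non_pseudo_frobenius \<Lambda>)"
proof -
  have fin: "finite (gaps \<Lambda>)" and ne: "gaps \<Lambda> \<noteq> {}"
    using assms by (auto simp: numerical_semigroup_def genus_def card_gt_0_iff)
  define F where "F = Max (gaps \<Lambda>)"
  have F: "F \<in> gaps \<Lambda>" "\<And>x. x > F \<Longrightarrow> x \<in> \<Lambda>"
    using Max_in[OF fin ne] Max_ge[OF fin] by (auto simp: F_def gaps_def not_le[symmetric])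
  have nonneg: "x \<ge> 0" if x: "x \<in> pseudo_frobenius \<Lambda>" for x
  proof (rule ccontr)
    assume neg: "\<not> x \<ge> 0"
    then have "F + nat (- x) \<in> \<Lambda> - {0}"
      using F(2)[of "F + nat (- x)"] by auto
    then have "x + int (F + nat (- x)) \<in> int ` \<Lambda>"
      using x unfolding pseudo_frobenius_def by blast
    then show False
      using neg F(1) by (auto simp: gaps_def)
  qed
  have nat_iff: "int x \<in> pseudo_frobenius \<Lambda> \<longleftrightarrow> x \<in> gaps \<Lambda> - non_pseudo_frobenius \<Lambda>" for x
  proof -
    have "int x + int y \<in> int ` \<Lambda> \<longleftrightarrow> x + y \<in> \<Lambda>" for y
      by (metis image_iff of_nat_add of_nat_eq_iff)
    then show ?thesis
      by (auto simp: pseudo_frobenius_def gaps_def non_pseudo_frobenius_def)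
  qed
  show ?thesis
  proof (intro equalityI subsetI)
    fix x assume x: "x \<in> pseudo_frobenius \<Lambda>"
    then have "x = int (nat x)"
      using nonneg by simp
    then show "x \<in> int ` (gaps \<Lambda> - non_pseudo_frobenius \<Lambda>)"
      using x nat_iff[of "nat x"] by (metis imageI)
  qed (use nat_iff in auto)
qed

lemma semigroup_type_eq:
  assumes "numerical_semigroup \<Lambda>" "genus \<Lambda> > 0"
  shows "semigroup_type \<Lambda> = card (gaps \<Lambda> - non_pseudo_frobenius \<Lambda>)"
  unfolding semigroup_type_def pseudo_frobenius_eq_image[OF assms]
  by (rule card_image) simp

text \<open>Turns "type g - l" into "exactly l gaps are not pseudo-Frobenius", the quantity counted
  from here on.\<close>

lemma genus_eq_type_plus:
  assumes "numerical_semigroup \<Lambda>" "genus \<Lambda> > 0"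
  shows "genus \<Lambda> = semigroup_type \<Lambda> + card (non_pseudo_frobenius \<Lambda>)"
proof -
  have fin: "finite (gaps \<Lambda>)"
    using assms by (simp add: numerical_semigroup_def)
  note sub = non_pseudo_frobenius_subset_gaps[OF assms(1)]
  have "card (non_pseudo_frobenius \<Lambda>) \<le> card (gaps \<Lambda>)"
    using card_mono[OF fin sub] .
  then show ?thesis
    using card_Diff_subset[OF finite_subset[OF sub fin] sub]
    by (simp add: semigroup_type_eq[OF assms] genus_def)
qed

text \<open>Pseudo-Frobenius numbers lie in distinct nonzero residue classes modulo any nonzero element.\<close>

lemma semigroup_type_less:
  assumes sg: "numerical_semigroup \<Lambda>" and "genus \<Lambda> > 0" and m: "m \<in> \<Lambda>" "m > 0"
  shows "semigroup_type \<Lambda> < m"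
proof -
  let ?P = "gaps \<Lambda> - non_pseudo_frobenius \<Lambda>"
  have "inj_on (\<lambda>x. x mod m) ?P"
  proof (rule linorder_inj_onI)
    fix x y assume "x < y" and x: "x \<in> ?P" and y: "y \<in> ?P"
    show "x mod m \<noteq> y mod m"
    proof
      assume "x mod m = y mod m"
      then have "m dvd y - x"
        using \<open>x < y\<close> by (metis less_imp_le mod_eq_dvd_iff_nat)
      then obtain k where k: "y = x + m * k"
        using \<open>x < y\<close> by (metis dvdE le_add_diff_inverse less_imp_le)
      then have "m * k \<in> \<Lambda> - {0}"
        using mult_mem_numerical_semigroup[OF sg m(1)] \<open>x < y\<close> by auto
      then show False
        using x y k by (auto simp: non_pseudo_frobenius_def)
    qed
  qed auto
  then have "card ?P = card ((\<lambda>x. x mod m) ` ?P)"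
    by (simp add: card_image)
  also have "\<dots> \<le> card {1..<m}"
  proof (rule card_mono)
    show "(\<lambda>x. x mod m) ` ?P \<subseteq> {1..<m}"
    proof
      fix r assume "r \<in> (\<lambda>x. x mod m) ` ?P"
      then obtain x where x: "x \<in> ?P" "r = x mod m"
        by blast
      \<comment> \<open>Multiples of \<open>m\<close> lie in \<open>\<Lambda>\<close>, so a gap
        avoids residue 0 and only m - 1 classes remain.\<close>
      have "x mod m \<noteq> 0"
        using x(1) mult_mem_numerical_semigroup[OF sg m(1), of "x div m"]
        by (auto simp: gaps_def mod_eq_0_iff_dvd)
      then show "r \<in> {1..<m}"
        using x m by auto
    qed
  qed simp
  finally show ?thesis
    using m semigroup_type_eq[OF assms(1,2)] by auto
qed

text \<open>Every nonzero element of \<open>\<Lambda>\<close> is k + a with a > 0 outside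
  \<open>S\<close>, and every gap above \<open>k\<close> is k + b with b in \<open>S\<close>. So
  \<open>d + y\<close> being a gap reads: a + d is in \<open>S\<close>. The shift \<open>k\<close>
  cancels.\<close>

lemma non_pseudo_frobenius_eq_gap_differences:
  assumes "gaps \<Lambda> = {1..k} \<union> (+) k ` S" and S: "S \<subseteq> {1..N}"
  shows "non_pseudo_frobenius \<Lambda> = gap_differences N S"
proof -
  have \<Lambda>: "y \<in> \<Lambda> \<longleftrightarrow> y \<notin> {1..k} \<union> (+) k ` S" for y
    using assms(1) by (auto simp: gaps_def)
  show ?thesis
  proof (intro equalityI subsetI)
    fix d assume "d \<in> non_pseudo_frobenius \<Lambda>"
    then obtain y where y: "y \<in> \<Lambda>" "y \<noteq> 0" "d + y \<in> gaps \<Lambda>"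
      by (auto simp: non_pseudo_frobenius_def)
    have "y > k"
      using y \<Lambda> by auto
    then obtain a where a: "y = k + a" "a > 0"
      using less_imp_add_positive by blast
    have "a \<notin> S"
      using y(1) a \<Lambda> by auto
    moreover have "a + d \<in> S"
      using y(3) a assms(1) by (auto simp: ac_simps)
    \<comment> \<open>\<open>a \<le> N\<close> because a + d is in \<open>S\<close>, and
      \<open>d > 0\<close> because \<open>a\<close> is not.\<close>
    ultimately show "d \<in> gap_differences N S"
      using a S by (force simp: gap_differences_def intro!: bexI[of _ a] gr0I)
  next
    fix d assume "d \<in> gap_differences N S"
    then obtain a where a: "a \<in> {1..N}" "a \<notin> S" "a + d \<in> S"
      by (auto simp: gap_differences_def)
    have "k + a \<in> \<Lambda> - {0}"
      using a \<Lambda> by auto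
    moreover have "d + (k + a) \<in> gaps \<Lambda>"
      using a(3) assms(1) by (auto simp: ac_simps intro!: image_eqI[of _ _ "a + d"])
    ultimately show "d \<in> non_pseudo_frobenius \<Lambda>"
      by (auto simp: non_pseudo_frobenius_def)
  qed
qed

section \<open>Stability as a count of differences\<close>

lemma stable_gap_vector_iff:
  fixes v :: "nat \<Rightarrow> int"
  assumes l: "l \<ge> 1" and card: "card {i \<in> {1..2 * l}. v i = 1} = l"
    and binary: "\<forall>i\<in>{1..2 * l}. v i = 0 \<or> v i = 1"
  shows "stable_gap_vector l v \<longleftrightarrow>
    card (gap_differences (2 * l) {i \<in> {1..2 * l}. v i = 1}) = l"
    (is "_ \<longleftrightarrow> card (gap_differences _ ?S) = l")
proof
  assume "stable_gap_vector l v"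
  then obtain \<Lambda> where g: "genus \<Lambda> \<ge> 3 * l - 1" and sg: "numerical_semigroup \<Lambda>"
    and type: "semigroup_type \<Lambda> = genus \<Lambda> - l"
    and v: "\<And>i. i \<in> {1..2 * l} \<Longrightarrow> v i = gap_vector l \<Lambda> i"
    by (auto simp: stable_gap_vector_def)
  have pos: "genus \<Lambda> > 0"
    using g l by simp
  define k where "k = genus \<Lambda> - l"
  \<comment> \<open>Positive elements of \<open>\<Lambda>\<close> exceed the type, which is
    \<open>k\<close>.\<close>
  have "{1..k} \<subseteq> gaps \<Lambda>"
    using semigroup_type_less[OF sg pos] type by (force simp: k_def gaps_def)
  moreover have "(+) k ` ?S \<subseteq> gaps \<Lambda>"
    using v by (auto simp: gap_vector_def k_def split: if_splits)
  moreover have "card ({1..k} \<union> (+) k ` ?S) = k + l"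
    using card by (subst card_Un_disjoint) (auto simp: card_image)
  moreover have "k + l = genus \<Lambda>"
    using g l by (simp add: k_def)
  moreover have "finite (gaps \<Lambda>)"
    using sg by (simp add: numerical_semigroup_def)
  \<comment> \<open>The gaps found so far already number k + l, the genus, so there are no
    others.\<close>
  ultimately have "{1..k} \<union> (+) k ` ?S = gaps \<Lambda>"
    by (intro card_subset_eq) (simp_all add: genus_def)
  then have "non_pseudo_frobenius \<Lambda> = gap_differences (2 * l) ?S"
    by (intro non_pseudo_frobenius_eq_gap_differences) auto
  then show "card (gap_differences (2 * l) ?S) = l"
    using genus_eq_type_plus[OF sg pos] type \<open>k + l = genus \<Lambda>\<close> by simp
next
  assume D: "card (gap_differences (2 * l) ?S) = l"
  \<comment> \<open>This is g - l for the least admissible genus g = 3l - 1.\<close>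
  define k where "k = 2 * l - 1"
  define \<Lambda> where "\<Lambda> = - ({1..k} \<union> (+) k ` ?S)"
  have gaps: "gaps \<Lambda> = {1..k} \<union> (+) k ` ?S"
    by (auto simp: \<Lambda>_def gaps_def)
  have "card ({1..k} \<union> (+) k ` ?S) = k + l"
    using card by (subst card_Un_disjoint) (auto simp: card_image)
  then have genus: "genus \<Lambda> = 3 * l - 1"
    unfolding genus_def gaps using l by (simp add: k_def)
  \<comment> \<open>The largest possible gap is k + 2l = 4l - 1, while two nonzero elements have sum
    at least 4l.\<close>
  have large: "y \<in> \<Lambda>" if "y \<ge> 4 * l" for y
    using that l by (auto simp: \<Lambda>_def k_def)
  have small: "y \<ge> 2 * l" if "y \<in> \<Lambda>" "y \<noteq> 0" for y
    using that by (auto simp: \<Lambda>_def k_def)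
  have "x + y \<in> \<Lambda>" if "x \<in> \<Lambda>" "y \<in> \<Lambda>" for x y
    using that large[of "x + y"] small[of x] small[of y] by (cases "x = 0"; cases "y = 0") auto
  moreover have "0 \<in> \<Lambda>"
    using l by (auto simp: \<Lambda>_def k_def)
  ultimately have sg: "numerical_semigroup \<Lambda>"
    using gaps by (auto simp: numerical_semigroup_def)
  have "non_pseudo_frobenius \<Lambda> = gap_differences (2 * l) ?S"
    by (rule non_pseudo_frobenius_eq_gap_differences[OF gaps]) auto
  then have "semigroup_type \<Lambda> = genus \<Lambda> - l"
    using genus_eq_type_plus[OF sg] genus l D by simp
  moreover have "v i = gap_vector l \<Lambda> i" if "i \<in> {1..2 * l}" for i
  proof -
    have "genus \<Lambda> - l + i = k + i"
      using l by (simp add: genus k_def)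
    moreover have "k + i \<in> gaps \<Lambda> \<longleftrightarrow> v i = 1"
      using that gaps by auto
    ultimately show ?thesis
      using binary that by (auto simp: gap_vector_def)
  qed
  ultimately show "stable_gap_vector l v"
    unfolding stable_gap_vector_def using sg genus
    by (intro exI[of _ "genus \<Lambda>"] exI[of _ \<Lambda>] conjI) auto
qed

section \<open>Counting differences in the five families\<close>

lemma card_eq_iff_subset:
  assumes "A \<subseteq> B" "finite B"
  shows "card B = card A \<longleftrightarrow> B \<subseteq> A"
  using assms by (metis card_subset_eq order_refl subset_antisym)

text \<open>From the zero \<open>i\<close>, the ones up to \<open>l\<close> give 1, ..., l - i, and
  the one at l + k gives l + k - i. The zeros just below l + k add 1, ..., k - 1. As l + k - i
  exceeds all the others, the count is 1 + max (l - i) (k - 1).\<close>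

lemma card_gap_differences_one_zero:
  assumes "i \<in> {1..l}" "k \<in> {1..l}"
  shows "card (gap_differences (2 * l) ({1..l} - {i} \<union> {l + k})) = l \<longleftrightarrow> i = 1 \<or> k = l"
proof -
  let ?S = "{1..l} - {i} \<union> {l + k}" and ?M = "max (l - i) (k - 1)"
  have "gap_differences (2 * l) ?S = insert (l + k - i) {1..?M}"
  proof (intro equalityI subsetI)
    fix d assume "d \<in> gap_differences (2 * l) ?S"
    then show "d \<in> insert (l + k - i) {1..?M}"
      using assms by (auto simp: gap_differences_def)
  next
    fix d assume "d \<in> insert (l + k - i) {1..?M}"
    then consider "d = l + k - i" | "1 \<le> d" "d \<le> l - i" | "1 \<le> d" "d \<le> k - 1"
      by fastforce
    then show "d \<in> gap_differences (2 * l) ?S"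
    proof cases
      case 3
      then show ?thesis
        using assms by (auto simp: gap_differences_def intro!: bexI[of _ "l + k - d"])
    qed (use assms in \<open>auto simp: gap_differences_def intro!: bexI[of _ i]\<close>)
  qed
  moreover have "l + k - i \<notin> {1..?M}"
    using assms by auto
  ultimately have "card (gap_differences (2 * l) ?S) = Suc ?M"
    by simp
  then show ?thesis
    using assms by auto
qed

text \<open>The least zero is at l - 1 or later, so differences are at most n + 1. Counting down
  from l + n reaches every value in \<open>{1..n + 1}\<close> except n - m, which would start at the
  one l + m. Counting down from l + m recovers n - m exactly when n - m is at most m + 1. The count
  is thus n + 1 or n.\<close>

lemma card_gap_differences_ones_then_pair:
  assumes l: "l \<ge> 2" and mn: "m < n" "n \<le> l"
  shows "card (gap_differences (2 * l) ({1..l - 2} \<union> {l + m, l + n})) = l \<longleftrightarrow>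
    (n = l - 1 \<and> l \<le> 2 * m + 2) \<or> (n = l \<and> 2 * m + 2 \<le> l)"
proof -
  let ?S = "{1..l - 2} \<union> {l + m, l + n}"
  have D: "d \<in> gap_differences (2 * l) ?S \<longleftrightarrow>
      d \<in> {1..n + 1} \<and> (d = n - m \<longrightarrow> d \<le> m + 1)" for d
  proof
    assume "d \<in> gap_differences (2 * l) ?S"
    then obtain a where "1 \<le> a" "a \<notin> ?S" "a + d \<in> ?S" "0 < d"
      by (rule gap_differencesE)
    then have "l \<le> a + 1" "a \<noteq> l + m" "a + d = l + m \<or> a + d = l + n" "0 < d"
      by auto
    then show "d \<in> {1..n + 1} \<and> (d = n - m \<longrightarrow> d \<le> m + 1)"
      using l mn by auto
  next
    assume d: "d \<in> {1..n + 1} \<and> (d = n - m \<longrightarrow> d \<le> m + 1)"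
    show "d \<in> gap_differences (2 * l) ?S"
    proof (cases "d = n - m")
      case True
      then show ?thesis
        using d l mn by (auto simp: gap_differences_def intro!: bexI[of _ "l + m - d"])
    next
      case False
      then show ?thesis
        using d l mn by (auto simp: gap_differences_def intro!: bexI[of _ "l + n - d"])
    qed
  qed
  have "gap_differences (2 * l) ?S = (if n \<le> 2 * m + 1 then {1..n + 1} else {1..n + 1} - {n - m})"
  proof (rule set_eqI)
    fix d
    show "d \<in> gap_differences (2 * l) ?S \<longleftrightarrow>
        d \<in> (if n \<le> 2 * m + 1 then {1..n + 1} else {1..n + 1} - {n - m})"
      unfolding D using mn by auto
  qed
  moreover have "card ({1..n + 1} - {n - m}) = n"
    using mn by (subst card_Diff_singleton) auto
  ultimately have "card (gap_differences (2 * l) ?S) = (if n \<le> 2 * m + 1 then n + 1 else n)"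
    by simp
  then show ?thesis
    using l mn by auto
qed

text \<open>Zeros sit at odd and ones at even positions, so differences are odd; the zero at 1
  already realises all odd numbers below 2l.\<close>

lemma gap_differences_evens:
  "gap_differences (2 * l) ((*) 2 ` {1..l}) = (\<lambda>j. 2 * j + 1) ` {..<l}"
proof (intro equalityI subsetI)
  fix d assume "d \<in> gap_differences (2 * l) ((*) 2 ` {1..l})"
  then obtain a b where a: "a \<in> {1..2 * l}" "a \<notin> (*) 2 ` {1..l}" and b: "a + d = 2 * b" "b \<le> l"
    by (auto simp: gap_differences_def)
  have "odd a"
    using a by (auto elim!: evenE)
  then have "odd d"
    using b(1) by presburger
  then obtain j where "d = 2 * j + 1"
    by (rule oddE)
  then show "d \<in> (\<lambda>j. 2 * j + 1) ` {..<l}"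
    using a b by auto
next
  fix d assume "d \<in> (\<lambda>j. 2 * j + 1) ` {..<l}"
  then obtain j where j: "d = 2 * j + 1" "j < l"
    by auto
  have "1 + d = 2 * (j + 1)" "1 \<notin> (*) (2::nat) ` {1..l}"
    using j by auto
  then show "d \<in> gap_differences (2 * l) ((*) 2 ` {1..l})"
    using j by (auto simp: gap_differences_def intro!: bexI[of _ 1] image_eqI[of _ _ "j + 1"])
qed

text \<open>
  In the last two families the differences with the zero at position 1 already give \<open>l\<close> values,
  so everything depends on whether one further value (\<open>l - 2\<close>, resp. \<open>l - 1\<close>) occurs.
\<close>

lemma card_gap_differences_zeros_1_pred:
  assumes l: "l \<ge> 5" and mn: "1 \<le> m" "m < n" "n \<le> l"
  shows "card (gap_differences (2 * l) ({2..l - 2} \<union> {l} \<union> {l + m, l + n})) = l \<longleftrightarrow>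
    (n \<le> l - 2 \<and> m \<noteq> l - 3 \<and> n \<noteq> l - 3) \<or> (m = 1 \<and> n = l - 1) \<or> (l \<ge> 6 \<and> m = 2 \<and> n = l)"
    (is "card ?D = l \<longleftrightarrow> ?R")
proof -
  obtain k where k: "l = k + 5"
    using l by (metis add.commute le_Suc_ex)
  let ?S = "{2..l - 2} \<union> {l} \<union> {l + m, l + n}"
  \<comment> \<open>Differences from the zero at 1, in the order of the ones. They are distinct
    since l + m - 1 is at least l; below l only l - 2 is missing.\<close>
  let ?P = "{1..l - 3} \<union> {l - 1, l + m - 1, l + n - 1}"
  have "?P \<subseteq> ?D"
    using l mn by (auto simp: gap_differences_def intro!: bexI[of _ 1])
  moreover have "card ?P = l"
    using l mn by (subst card_Un_disjoint) (auto simp: card_insert_if)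
  moreover have "finite ?D"
    by (rule finite_subset[of _ "{..2 * l}"]) (use mn in \<open>auto simp: gap_differences_def\<close>)
  ultimately have "card ?D = l \<longleftrightarrow> ?D \<subseteq> ?P"
    using card_eq_iff_subset by metis
  also have "\<dots> \<longleftrightarrow> ?R"
  proof
    assume DP: "?D \<subseteq> ?P"
    have "l - 2 \<notin> ?P"
      using l mn by auto
    then have "l - 2 \<notin> ?D"
      using DP by blast
    \<comment> \<open>The zeros l - 1, l + 1 and l + 2 can produce l - 2, by reaching 2l - 3, 2l - 1
      and 2l respectively.\<close>
    moreover have "l - 2 \<in> ?D" if "m = l - 3 \<or> n = l - 3"
      using that l mn by (auto simp: gap_differences_def intro!: bexI[of _ "l - 1"])
    moreover have "l - 2 \<in> ?D" if "n = l - 1" "m \<noteq> 1"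
      using that l mn by (auto simp: gap_differences_def intro!: bexI[of _ "l + 1"])
    moreover have "l - 2 \<in> ?D" if "n = l" "m \<noteq> 2"
      using that l mn by (auto simp: gap_differences_def intro!: bexI[of _ "l + 2"])
    ultimately have "m \<noteq> l - 3" "n \<noteq> l - 3" "n = l - 1 \<longrightarrow> m = 1" "n = l \<longrightarrow> m = 2"
      by blast+
    \<comment> \<open>The bound \<open>l \<ge> 6\<close> arises here: if n = l then m = 2, and
      \<open>m \<noteq> l - 3\<close> excludes l = 5.\<close>
    then show ?R
      using mn unfolding k by auto
  next
    assume R: ?R
    have R': "m \<le> l - 2" "m \<noteq> l - 3" "n \<noteq> l - 3" "n = l - 1 \<longrightarrow> m = 1" "n = l \<longrightarrow> m = 2"
      using R mn unfolding k by auto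
    show "?D \<subseteq> ?P"
    proof
      fix d assume "d \<in> ?D"
      then obtain a where a: "1 \<le> a" "a \<notin> ?S" "a + d \<in> ?S" "0 < d"
        by (rule gap_differencesE)
      have "a < 2 \<or> l - 2 < a" "a \<noteq> l"
        using a(2) by auto
      then consider "a = 1" | "a = l - 1" | "a > l"
        using a(1) unfolding k by linarith
      then show "d \<in> ?P"
      proof cases
        case 1
        then show ?thesis
          using a(3,4) by auto
      next
        case 2
        then have "d = 1 \<or> d = m + 1 \<or> d = n + 1"
          using a(3,4) unfolding k by auto
        moreover have "m + 1 \<in> ?P" "1 \<in> ?P"
          using R'(1-3) mn unfolding k by auto
        \<comment> \<open>When n is l - 1 or l, the value of m is 1 or 2, and n + 1 coincides with l
          + m - 1.\<close>
        moreover have "n + 1 \<in> ?P"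
          using R'(3-5) mn unfolding k by (cases "n = k + 5"; cases "n = k + 4") auto
        ultimately show ?thesis
          by blast
      next
        case 3
        then have "a + d = l + m \<or> a + d = l + n" "a \<noteq> l + m"
          using a(2,3) by auto
        then have "d < n"
          using 3 mn by auto
        \<comment> \<open>Since d < n, only l - 2 can fall outside \<open>?P\<close>. Reaching l + n
          by that step forces a = n + 2, which then equals l + m, a one.\<close>
        have "d \<noteq> l - 2"
        proof
          assume d: "d = l - 2"
          show False
            using \<open>a + d = l + m \<or> a + d = l + n\<close>
          proof
            assume "a + d = l + m"
            then show False
              using 3 d R'(1) l by linarith
          next
            assume "a + d = l + n"
            then have "n = l \<or> n = l - 1" "a = n + 2"
              using 3 d l mn by auto
            then show False
              using \<open>a \<noteq> l + m\<close> R'(4,5) l by auto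
          qed
        qed
        then show ?thesis
          using \<open>d < n\<close> a(4) mn by auto
      qed
    qed
  qed
  finally show ?thesis .
qed

lemma card_gap_differences_zeros_1_mid:
  assumes l: "l \<ge> 3" and mn: "1 \<le> m" "m < n" "n \<le> l"
  shows "card (gap_differences (2 * l) ({2..l - 1} \<union> {l + m, l + n})) = l \<longleftrightarrow>
    (2 \<le> m \<and> n \<le> l - 2) \<or> (m = 1 \<and> n \<noteq> l - 1)"
    (is "card ?D = l \<longleftrightarrow> ?R")
proof -
  let ?S = "{2..l - 1} \<union> {l + m, l + n}"
  \<comment> \<open>Again the differences from the zero at 1; now l - 1 is the missing value. Below,
    the zeros \<open>l\<close> and l + 1 produce it by reaching 2l - 1 and 2l.\<close>
  let ?P = "{1..l - 2} \<union> {l + m - 1, l + n - 1}"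
  have "?P \<subseteq> ?D"
    using l mn by (auto simp: gap_differences_def intro!: bexI[of _ 1])
  moreover have "card ?P = l"
    using l mn by (subst card_Un_disjoint) (auto simp: card_insert_if)
  moreover have "finite ?D"
    by (rule finite_subset[of _ "{..2 * l}"]) (use mn in \<open>auto simp: gap_differences_def\<close>)
  ultimately have "card ?D = l \<longleftrightarrow> ?D \<subseteq> ?P"
    using card_eq_iff_subset by metis
  also have "\<dots> \<longleftrightarrow> ?R"
  proof
    assume DP: "?D \<subseteq> ?P"
    have "l - 1 \<notin> ?P"
      using l mn by auto
    then have "l - 1 \<notin> ?D"
      using DP by blast
    moreover have "l - 1 \<in> ?D" if "n = l - 1"
      using that l mn by (auto simp: gap_differences_def intro!: bexI[of _ l])
    moreover have "l - 1 \<in> ?D" if "n = l" "m \<noteq> 1"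
      using that l mn by (auto simp: gap_differences_def intro!: bexI[of _ "l + 1"])
    ultimately have "n \<noteq> l - 1" "n = l \<longrightarrow> m = 1"
      by blast+
    then show ?R
      using l mn by linarith
  next
    assume R: ?R
    show "?D \<subseteq> ?P"
    proof
      fix d assume "d \<in> ?D"
      then obtain a where a: "1 \<le> a" "a \<notin> ?S" "a + d \<in> ?S" "0 < d"
        by (rule gap_differencesE)
      then consider "a = 1" | "a = l" | "a > l"
        by fastforce
      then show "d \<in> ?P"
        \<comment> \<open>For a = l, \<open>d\<close> is \<open>m\<close> or \<open>n\<close>, and n
          = l forces m = 1, so n = l + m - 1. For a > l, d = l - 1 would need n = l and a = l + 1 =
          l + m, a one.\<close>
        by cases (use a R l mn in auto)
    qed
  qed
  finally show ?thesis .
qed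

section \<open>From the prescribed entries of \<open>v\<close> to explicit sets of ones\<close>

theorem proposition3p9:
  fixes l :: nat and v :: "nat \<Rightarrow> int"
  assumes "l \<ge> 1"
    and "card {i \<in> {1..2 * l}. v i = 0} = l"
    and "card {i \<in> {1..2 * l}. v i = 1} = l"
  shows
    "(\<forall>i. i \<in> {1..l} \<and> v i = 0 \<and> (\<forall>j\<in>{1..l}. v j = 0 \<longrightarrow> j = i) \<longrightarrow>
        (stable_gap_vector l v \<longleftrightarrow> i = 1 \<or> (2 \<le> i \<and> i \<le> l \<and> v (2 * l) = 1)))
   \<and> (\<forall>m n. (\<forall>j. 1 \<le> j \<and> j \<le> l - 2 \<longrightarrow> v j = 1) \<and> m < n \<and> n \<le> l \<and>
          v (l + m) = 1 \<and> v (l + n) = 1 \<longrightarrow>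
        (stable_gap_vector l v \<longleftrightarrow>
            (n = l - 1 \<and> real l / 2 - 1 \<le> real m \<and> m \<le> l - 2)
          \<or> (n = l \<and> real m \<le> real l / 2 - 1)))
   \<and> ((\<forall>j\<in>{1..l}. v (2 * j) = 1) \<longrightarrow> stable_gap_vector l v)
   \<and> (\<forall>m n. l \<ge> 5 \<and> (\<forall>j. 2 \<le> j \<and> j \<le> l - 2 \<longrightarrow> v j = 1) \<and> v l = 1 \<and>
          1 \<le> m \<and> m < n \<and> n \<le> l \<and> v (l + m) = 1 \<and> v (l + n) = 1 \<longrightarrow>
        (stable_gap_vector l v \<longleftrightarrow>
            (n \<le> l - 2 \<and> m \<noteq> l - 3 \<and> n \<noteq> l - 3)
          \<or> (m = 1 \<and> n = l - 1)
          \<or> (l \<ge> 6 \<and> m = 2 \<and> n = l)))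
   \<and> (\<forall>m n. l \<ge> 3 \<and> (\<forall>j. 2 \<le> j \<and> j \<le> l - 1 \<longrightarrow> v j = 1) \<and>
          1 \<le> m \<and> m < n \<and> n \<le> l \<and> v (l + m) = 1 \<and> v (l + n) = 1 \<longrightarrow>
        (stable_gap_vector l v \<longleftrightarrow>
            (2 \<le> m \<and> n \<le> l - 2)
          \<or> (m = 1 \<and> n \<noteq> l - 1)))"
proof -
  let ?Z = "{i \<in> {1..2 * l}. v i = 0}" and ?S = "{i \<in> {1..2 * l}. v i = 1}"
  have "card (?Z \<union> ?S) = card {1..2 * l}"
    using assms by (subst card_Un_disjoint) auto
  then have "?Z \<union> ?S = {1..2 * l}"
    by (intro card_subset_eq) auto
  then have binary: "\<forall>i\<in>{1..2 * l}. v i = 0 \<or> v i = 1"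
    by blast
  note stable_iff = stable_gap_vector_iff[OF assms(1,3) binary]
  \<comment> \<open>Exhibiting l positions with entry 1 determines all the ones.\<close>
  have ones_eq: "?S = T" if "T \<subseteq> ?S" "card T = l" for T
    using card_subset_eq[of ?S T] that assms(3) by simp
  show ?thesis
  proof (intro conjI allI impI)
    fix i assume i: "i \<in> {1..l} \<and> v i = 0 \<and> (\<forall>j\<in>{1..l}. v j = 0 \<longrightarrow> j = i)"
    let ?L = "{1..l} - {i}"
    have L: "?L \<subseteq> ?S"
      using i binary by fastforce
    \<comment> \<open>\<open>?L\<close> accounts for l - 1 ones, so a single one remains, in the
      upper half.\<close>
    then have "card (?S - ?L) = 1"
      using assms i by (subst card_Diff_subset) auto
    then obtain b where b: "?S - ?L = {b}"
      by (auto simp: card_1_singleton_iff)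
    then have "b \<in> ?S" "b \<notin> ?L"
      by blast+
    then have vb: "v b = 1" and "1 \<le> b" "b \<le> 2 * l" "l < b \<or> b = i"
      by auto
    moreover have "b \<noteq> i"
      using vb i by (metis zero_neq_one)
    ultimately obtain k where k: "b = l + k" "k \<in> {1..l}"
      by (intro that[of "b - l"]) auto
    have S: "?S = ?L \<union> {l + k}"
      using L b k by blast
    have "v (2 * l) = 1 \<longleftrightarrow> 2 * l \<in> ?S"
      using assms(1) by auto
    also have "\<dots> \<longleftrightarrow> k = l"
      unfolding S using k assms(1) by auto
    finally have v2l: "v (2 * l) = 1 \<longleftrightarrow> k = l" .
    have il: "i \<in> {1..l}"
      using i by blast
    have "stable_gap_vector l v \<longleftrightarrow> i = 1 \<or> k = l"
      unfolding stable_iff S by (rule card_gap_differences_one_zero[OF il k(2)])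
    then show "stable_gap_vector l v \<longleftrightarrow> i = 1 \<or> (2 \<le> i \<and> i \<le> l \<and> v (2 * l) = 1)"
      unfolding v2l using il by auto
  next
    fix m n
    assume a: "(\<forall>j. 1 \<le> j \<and> j \<le> l - 2 \<longrightarrow> v j = 1) \<and> m < n \<and> n \<le> l \<and>
      v (l + m) = 1 \<and> v (l + n) = 1"
    \<comment> \<open>For l = 1 the hypotheses force m = 0 and n = 1, making both entries 1 and
      leaving no zero.\<close>
    have l: "l \<ge> 2"
    proof (rule ccontr)
      assume "\<not> l \<ge> 2"
      then have "l = 1" "m = 0" "n = 1"
        using assms(1) a by auto
      then have "?Z = {}"
        using a by (auto simp: numeral_2_eq_2 le_Suc_eq)
      then have "card ?Z = 0"
        by (simp only: card.empty)
      then show False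
        using assms(1,2) by linarith
    qed
    have "card ({1..l - 2} \<union> {l + m, l + n}) = l"
      using l a by (subst card_Un_disjoint) auto
    then have S: "?S = {1..l - 2} \<union> {l + m, l + n}"
      using l a by (intro ones_eq) auto
    have "real l / 2 - 1 \<le> real m \<longleftrightarrow> l \<le> 2 * m + 2" "real m \<le> real l / 2 - 1 \<longleftrightarrow> 2 * m + 2 \<le> l"
      by linarith+
    then show "stable_gap_vector l v \<longleftrightarrow>
        (n = l - 1 \<and> real l / 2 - 1 \<le> real m \<and> m \<le> l - 2) \<or> (n = l \<and> real m \<le> real l / 2 - 1)"
      using card_gap_differences_ones_then_pair[OF l, of m n] a l unfolding stable_iff S by auto
  next
    assume a: "\<forall>j\<in>{1..l}. v (2 * j) = 1"
    have "card ((*) 2 ` {1..l}) = l"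
      by (simp add: card_image inj_on_def)
    then have S: "?S = (*) 2 ` {1..l}"
      using a by (intro ones_eq) auto
    show "stable_gap_vector l v"
      unfolding stable_iff S gap_differences_evens by (simp add: card_image inj_on_def)
  next
    fix m n
    assume a: "l \<ge> 5 \<and> (\<forall>j. 2 \<le> j \<and> j \<le> l - 2 \<longrightarrow> v j = 1) \<and> v l = 1 \<and>
      1 \<le> m \<and> m < n \<and> n \<le> l \<and> v (l + m) = 1 \<and> v (l + n) = 1"
    have "card ({2..l - 2} \<union> {l} \<union> {l + m, l + n}) = l"
      using a by (subst card_Un_disjoint) auto
    then have S: "?S = {2..l - 2} \<union> {l} \<union> {l + m, l + n}"
      using a by (intro ones_eq) auto
    show "stable_gap_vector l v \<longleftrightarrow>
        (n \<le> l - 2 \<and> m \<noteq> l - 3 \<and> n \<noteq> l - 3) \<or> (m = 1 \<and> n = l - 1) \<or> (l \<ge> 6 \<and> m = 2 \<and> n = l)"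
      unfolding stable_iff S using a by (intro card_gap_differences_zeros_1_pred) auto
  next
    fix m n
    assume a: "l \<ge> 3 \<and> (\<forall>j. 2 \<le> j \<and> j \<le> l - 1 \<longrightarrow> v j = 1) \<and>
      1 \<le> m \<and> m < n \<and> n \<le> l \<and> v (l + m) = 1 \<and> v (l + n) = 1"
    have "card ({2..l - 1} \<union> {l + m, l + n}) = l"
      using a by (subst card_Un_disjoint) auto
    then have S: "?S = {2..l - 1} \<union> {l + m, l + n}"
      using a by (intro ones_eq) auto
    show "stable_gap_vector l v \<longleftrightarrow> (2 \<le> m \<and> n \<le> l - 2) \<or> (m = 1 \<and> n \<noteq> l - 1)"
      unfolding stable_iff S using a by (intro card_gap_differences_zeros_1_mid) auto
  qed
qed

end
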